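(* Let $\alpha>0$ and let $n\ge0$ be an integer. Assume that for every integer $k\ge n$ one has $a_k<1$, where $$a_k=\frac{\Gamma(1+k)}{n!\,\Gamma(1+k-n)^2}\int_0^\infty\frac{e^{-r}r^{k-n}}{L_n(-r)}\,dr .$$ Then for every $f\in\mathcal{F}_\alpha^2$, $$I_n(f):=\frac{\alpha}{\pi}\int_{\mathbb{C}}\frac{|f^{(n)}(z)|^2e^{-\alpha|z|^2}}{\alpha^n\,n!\,L_n(-\alpha|z|^2)}\,dx\,dy\le\|f\|_{2,\alpha}^2 ,$$ and this inequality is sharp, in the sense that for every $c<1$ there exists a nonzero $f\in\mathcal{F}_\alpha^2$ with $I_n(f)>c\,\|f\|_{2,\alpha}^2$.
   Context: $z=x+iy$, and $dx\,dy$ is Lebesgue measure on $\mathbb{C}$. For $\alpha>0$, the Fock space $\mathcal{F}_\alpha^2$ is the space of all entire functions $f$ with $$\|f\|_{2,\alpha}^2=\frac{\alpha}{\pi}\int_{\mathbb{C}}|f(z)|^2e^{-\alpha|z|^2}\,dx\,dy<\infty .$$ $L_n$ is the Laguerre polynomial $L_n(x)=\sum_{k=0}^n\binom{n}{k}\frac{(-1)^k}{k!}x^k$. *)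

theory Defs
  imports "HOL-Complex_Analysis.Complex_Analysis"
begin

definition laguerre :: "nat \<Rightarrow> real \<Rightarrow> real" where
  "laguerre n x = (\<Sum>k=0..n. real (n choose k) * ((-1) ^ k / fact k) * x ^ k)"

definition fock_space :: "real \<Rightarrow> (complex \<Rightarrow> complex) set" where
  "fock_space \<alpha> = {f. f holomorphic_on UNIV \<and>
     integrable lborel (\<lambda>z. (norm (f z))\<^sup>2 * exp (- \<alpha> * (norm z)\<^sup>2))}"

definition fock_norm :: "real \<Rightarrow> (complex \<Rightarrow> complex) \<Rightarrow> real" where
  "fock_norm \<alpha> f = sqrt (\<alpha> / pi * (LINT z|lborel. (norm (f z))\<^sup>2 * exp (- \<alpha> * (norm z)\<^sup>2)))"

definition weighted_deriv :: "real \<Rightarrow> nat \<Rightarrow> (complex \<Rightarrow> complex) \<Rightarrow> complex \<Rightarrow> real" where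
  "weighted_deriv \<alpha> n f z =
     (norm ((deriv ^^ n) f z))\<^sup>2 * exp (- \<alpha> * (norm z)\<^sup>2)
       / (\<alpha> ^ n * fact n * laguerre n (- \<alpha> * (norm z)\<^sup>2))"

text \<open>
  The Bochner integral of a non-integrable function is 0, so an upper bound on
  \<open>deriv_functional\<close> carries information only together with the integrability of
  \<open>weighted_deriv\<close>.
\<close>

definition deriv_functional :: "real \<Rightarrow> nat \<Rightarrow> (complex \<Rightarrow> complex) \<Rightarrow> real" where
  "deriv_functional \<alpha> n f = \<alpha> / pi * (LINT z|lborel. weighted_deriv \<alpha> n f z)"

text \<open>
  Meant for \<open>n \<le> k\<close>. The integrand is then integrable, since \<open>laguerre n (- r) \<ge> 1\<close>
  for \<open>r \<ge> 0\<close>.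
\<close>

definition monomial_ratio :: "nat \<Rightarrow> nat \<Rightarrow> real" where
  "monomial_ratio n k =
     Gamma (1 + real k) / (fact n * (Gamma (1 + real k - real n))\<^sup>2)
       * (LINT r:{0..}|lborel. exp (- r) * r ^ (k - n) / laguerre n (- r))"

end

theory Submission imports Defs "HOL-Probability.Sinc_Integral" begin

text \<open>
  Lebesgue measure on the plane is rotation invariant, so the integral of \<open>|g(z)|\<^sup>2\<close> against a
  radial weight may be averaged over circles. By Parseval it becomes a sum over the Taylor
  coefficients of \<open>g\<close>, in which each monomial contributes its own weighted norm. Taking for \<open>g\<close>
  the function \<open>f\<close> and its \<open>n\<close>-th derivative, the two sides of the inequality are compared term
  by term: the quotient of the terms belonging to \<open>z\<^sup>k\<close> is \<open>a\<^sub>k\<close>, which gives the bound.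
  Sharpness is tested on \<open>f = z\<^sup>k\<close>, because \<open>a\<^sub>k\<close> tends to 1.
\<close>

section \<open>Planar Lebesgue measure: iterated integrals and rotations\<close>

lemma borel_measurable_Complex [measurable (raw)]:
  fixes f g :: "'a \<Rightarrow> real"
  assumes [measurable]: "f \<in> borel_measurable M" "g \<in> borel_measurable M"
  shows "(\<lambda>x. Complex (f x) (g x)) \<in> borel_measurable M"
  unfolding Complex_eq by measurable

text \<open>Lebesgue measure is determined by its values on open boxes, and a box in the complex
  plane is the product of an interval of real parts and one of imaginary parts. This opens the way
  to Tonelli.\<close>

lemma lborel_complex_eq:
  "(lborel :: complex measure) = distr (lborel \<Otimes>\<^sub>M lborel) borel (\<lambda>(x, y). Complex x y)"
proof (rule lborel_eqI)
  fix l u :: complex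
  assume "\<And>b. b \<in> Basis \<Longrightarrow> l \<bullet> b \<le> u \<bullet> b"
  then have le: "Re l \<le> Re u" "Im l \<le> Im u"
    by (force simp: Basis_complex_def)+
  have "(\<lambda>(x, y). Complex x y) -` box l u \<inter> space (lborel \<Otimes>\<^sub>M lborel) =
      {Re l<..<Re u} \<times> {Im l<..<Im u}"
    by (auto simp: space_pair_measure in_box_complex_iff)
  then show "emeasure (distr (lborel \<Otimes>\<^sub>M lborel) borel (\<lambda>(x, y). Complex x y)) (box l u) =
      ennreal (\<Prod>b\<in>Basis. (u - l) \<bullet> b)"
    using le by (subst emeasure_distr)
      (auto simp: lborel.emeasure_pair_measure_Times Basis_complex_def ennreal_mult)
qed simp

lemma nn_integral_complex_iterated:
  fixes F :: "complex \<Rightarrow> ennreal"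
  assumes [measurable]: "F \<in> borel_measurable borel"
  shows "(\<integral>\<^sup>+z. F z \<partial>lborel) = (\<integral>\<^sup>+x. \<integral>\<^sup>+y. F (Complex x y) \<partial>lborel \<partial>lborel)"
  by (subst lborel_complex_eq, subst nn_integral_distr)
     (auto simp: lborel.nn_integral_fst[symmetric])

text \<open>
  The rotation is carried out by two one-dimensional affine substitutions, whose factors
  \<open>1 / cos t\<close> and \<open>cos t\<close> cancel; hence the condition on \<open>t\<close>.
\<close>

lemma nn_integral_rotate_aux:
  fixes F :: "complex \<Rightarrow> ennreal"
  assumes [measurable]: "F \<in> borel_measurable borel" and a: "cos t \<noteq> 0"
  shows "(\<integral>\<^sup>+z. F (cis t * z) \<partial>lborel) = (\<integral>\<^sup>+z. F z \<partial>lborel)"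
proof -
  define a b where "a = cos t" and "b = sin t"
  have a0: "a \<noteq> 0" and ab: "a * a + b * b = 1"
    using a sin_cos_squared_add[of t] by (auto simp: a_def b_def power2_eq_square)
  \<comment> \<open>The substitution \<open>y := (y - b * x) / a\<close> is chosen so that the
    imaginary part of the rotated point becomes the new variable; in the real part,
    \<open>a * a + b * b = 1\<close> then collapses the coefficient of \<open>x\<close>.\<close>
  have sub: "Complex (a * x - b * ((y - b * x) / a)) (b * x + a * ((y - b * x) / a)) =
      Complex ((x - b * y) / a) y" for x y
  proof -
    have "a * x - b * ((y - b * x) / a) = ((a * a + b * b) * x - b * y) / a"
      using a0 by (simp add: field_simps)
    then show ?thesis
      using a0 ab by simp
  qed
  have "(\<integral>\<^sup>+z. F (cis t * z) \<partial>lborel) =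
      (\<integral>\<^sup>+x. \<integral>\<^sup>+y. F (Complex (a * x - b * y) (b * x + a * y)) \<partial>lborel \<partial>lborel)"
    by (subst nn_integral_complex_iterated)
       (auto simp: a_def b_def complex_eq_iff algebra_simps intro!: nn_integral_cong arg_cong[of _ _ F])
  also have "\<dots> = (\<integral>\<^sup>+x. \<bar>1 / a\<bar> * (\<integral>\<^sup>+y. F (Complex ((x - b * y) / a) y) \<partial>lborel) \<partial>lborel)"
  proof (rule nn_integral_cong)
    fix x
    have "(\<integral>\<^sup>+y. F (Complex (a * x - b * y) (b * x + a * y)) \<partial>lborel) =
      \<bar>1 / a\<bar> * (\<integral>\<^sup>+y. F (Complex (a * x - b * (- b * x / a + 1 / a * y)) (b * x + a * (- b * x / a + 1 / a * y))) \<partial>lborel)"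
      using a0 by (intro nn_integral_real_affine) auto
    also have "(\<lambda>y. - b * x / a + 1 / a * y) = (\<lambda>y. (y - b * x) / a)"
      by (auto simp: diff_divide_distrib)
    then have "(\<lambda>y. F (Complex (a * x - b * (- b * x / a + 1 / a * y)) (b * x + a * (- b * x / a + 1 / a * y)))) =
      (\<lambda>y. F (Complex ((x - b * y) / a) y))"
      using sub[of x] by (metis (no_types, lifting))
    finally show "(\<integral>\<^sup>+y. F (Complex (a * x - b * y) (b * x + a * y)) \<partial>lborel) =
      \<bar>1 / a\<bar> * (\<integral>\<^sup>+y. F (Complex ((x - b * y) / a) y) \<partial>lborel)" .
  qed
  also have "\<dots> = (\<integral>\<^sup>+x. \<integral>\<^sup>+y. \<bar>1 / a\<bar> * F (Complex ((x - b * y) / a) y) \<partial>lborel \<partial>lborel)"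
    by (intro nn_integral_cong nn_integral_cmult[symmetric]) auto
  also have "\<dots> = (\<integral>\<^sup>+y. \<integral>\<^sup>+x. \<bar>1 / a\<bar> * F (Complex ((x - b * y) / a) y) \<partial>lborel \<partial>lborel)"
    by (intro lborel_pair.Fubini'[symmetric]) auto
  also have "\<dots> = (\<integral>\<^sup>+y. \<integral>\<^sup>+x. F (Complex x y) \<partial>lborel \<partial>lborel)"
  proof (rule nn_integral_cong)
    fix y
    \<comment> \<open>The second substitution is applied to the target integral, so its factor is
      the one already present on the other side.\<close>
    have "(\<integral>\<^sup>+x. F (Complex x y) \<partial>lborel) =
        \<bar>1 / a\<bar> * (\<integral>\<^sup>+x. F (Complex (- b * y / a + 1 / a * x) y) \<partial>lborel)"
      using a0 by (intro nn_integral_real_affine) auto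
    also have "(\<lambda>x. - b * y / a + 1 / a * x) = (\<lambda>x. (x - b * y) / a)"
      by (auto simp: diff_divide_distrib)
    then have "(\<lambda>x. F (Complex (- b * y / a + 1 / a * x) y)) = (\<lambda>x. F (Complex ((x - b * y) / a) y))"
      by (metis (no_types, lifting))
    finally show "(\<integral>\<^sup>+x. \<bar>1 / a\<bar> * F (Complex ((x - b * y) / a) y) \<partial>lborel) =
        (\<integral>\<^sup>+x. F (Complex x y) \<partial>lborel)"
      by (simp add: nn_integral_cmult)
  qed
  also have "\<dots> = (\<integral>\<^sup>+z. F z \<partial>lborel)"
    by (subst nn_integral_complex_iterated, simp, rule lborel_pair.Fubini') auto
  finally show ?thesis .
qed

text \<open>An angle with \<open>cos t = 0\<close> is split into two rotations by
  \<open>t / 2\<close>: if \<open>cos (t / 2)\<close> vanished, the double-angle formula would give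
  \<open>cos t = -1\<close>.\<close>

lemma nn_integral_rotate:
  fixes F :: "complex \<Rightarrow> ennreal"
  assumes [measurable]: "F \<in> borel_measurable borel"
  shows "(\<integral>\<^sup>+z. F (cis t * z) \<partial>lborel) = (\<integral>\<^sup>+z. F z \<partial>lborel)"
proof (cases "cos t = 0")
  case True
  then have half: "cos (t / 2) \<noteq> 0"
    using cos_double_cos[of "t / 2"] by auto
  have "(\<integral>\<^sup>+z. F (cis t * z) \<partial>lborel) = (\<integral>\<^sup>+z. F (cis (t / 2) * (cis (t / 2) * z)) \<partial>lborel)"
    by (simp add: cis_mult flip: mult.assoc)
  also have "\<dots> = (\<integral>\<^sup>+z. F (cis (t / 2) * z) \<partial>lborel)"
    by (rule nn_integral_rotate_aux[of "\<lambda>z. F (cis (t / 2) * z)"]) (use half in auto)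
  also have "\<dots> = (\<integral>\<^sup>+z. F z \<partial>lborel)"
    by (rule nn_integral_rotate_aux) (use half in auto)
  finally show ?thesis .
qed (simp add: nn_integral_rotate_aux)

section \<open>Radial integrals in the plane\<close>

text \<open>This takes the place of polar coordinates. The sublevel sets of
  \<open>\<alpha> * (norm z)\<^sup>2\<close> are discs whose area is linear in the level, so the
  image measure has constant density on the half-line; it is enough to compare half-lines, which are
  closed under intersection and generate the Borel sets.\<close>

lemma distr_lborel_norm_square:
  fixes \<alpha> :: real
  assumes \<alpha>: "\<alpha> > 0"
  shows "distr (lborel :: complex measure) borel (\<lambda>z. \<alpha> * (norm z)\<^sup>2) =
    density lborel (\<lambda>r. ennreal (pi / \<alpha>) * indicator {0..} r)"
proof (rule measure_eqI_generator_eq[where E = "range atMost" and \<Omega> = UNIV and A = "\<lambda>i. {..real i}"])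
  have preimage: "(\<lambda>z::complex. \<alpha> * (norm z)\<^sup>2) -` {..a} = cball 0 (sqrt (a / \<alpha>))" for a
  proof -
    have "\<alpha> * (norm z)\<^sup>2 \<le> a \<longleftrightarrow> norm z \<le> sqrt (a / \<alpha>)" for z :: complex
      using \<alpha> real_sqrt_le_iff[of "(norm z)\<^sup>2" "a / \<alpha>"]
      by (simp add: pos_le_divide_eq mult.commute)
    then show ?thesis
      by auto
  qed
  have atMost: "emeasure (distr (lborel :: complex measure) borel (\<lambda>z. \<alpha> * (norm z)\<^sup>2)) {..a} =
      (if a < 0 then 0 else ennreal (pi / \<alpha> * a))" for a
  proof (cases "a < 0")
    case True
    \<comment> \<open>The real \<open>sqrt\<close> is odd, hence negative at negative arguments; the
      disc in \<open>preimage\<close> is then empty, as it should be.\<close>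
    then have "sqrt (a / \<alpha>) < 0"
      using \<alpha> by (simp add: divide_neg_pos)
    then show ?thesis
      using True by (subst emeasure_distr) (auto simp: preimage)
  next
    case False
    then show ?thesis
      using \<alpha> by (subst emeasure_distr) (auto simp: preimage emeasure_cball unit_ball_vol_2)
  qed
  show "emeasure (distr (lborel :: complex measure) borel (\<lambda>z. \<alpha> * (norm z)\<^sup>2)) {..real i} \<noteq> \<infinity>" for i
    by (simp add: atMost)
  fix X :: "real set" assume "X \<in> range atMost"
  then obtain a where X: "X = {..a}"
    by auto
  have "emeasure (density lborel (\<lambda>r. ennreal (pi / \<alpha>) * indicator {0..} r)) X =
      (\<integral>\<^sup>+r. ennreal (pi / \<alpha>) * indicator {0..a} r \<partial>lborel)"
    unfolding X by (subst emeasure_density) (auto intro!: nn_integral_cong split: split_indicator)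
  also have "\<dots> = (if a < 0 then 0 else ennreal (pi / \<alpha> * a))"
    using \<alpha> by (subst nn_integral_cmult_indicator) (auto simp flip: ennreal_mult')
  finally show "emeasure (distr (lborel :: complex measure) borel (\<lambda>z. \<alpha> * (norm z)\<^sup>2)) X =
      emeasure (density lborel (\<lambda>r. ennreal (pi / \<alpha>) * indicator {0..} r)) X"
    using atMost[of a] X by simp
qed (auto simp: Int_stable_def borel_eq_atMost intro: real_arch_simple)

lemma nn_integral_radial:
  fixes \<alpha> :: real and h :: "real \<Rightarrow> ennreal"
  assumes "\<alpha> > 0" and [measurable]: "h \<in> borel_measurable borel"
  shows "(\<integral>\<^sup>+z. h (\<alpha> * (norm (z::complex))\<^sup>2) \<partial>lborel) =
    ennreal (pi / \<alpha>) * (\<integral>\<^sup>+r. h r * indicator {0..} r \<partial>lborel)"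
proof -
  have "(\<integral>\<^sup>+z. h (\<alpha> * (norm (z::complex))\<^sup>2) \<partial>lborel) =
      (\<integral>\<^sup>+r. h r \<partial>distr (lborel :: complex measure) borel (\<lambda>z. \<alpha> * (norm z)\<^sup>2))"
    by (subst nn_integral_distr) auto
  also have "\<dots> = (\<integral>\<^sup>+r. ennreal (pi / \<alpha>) * (h r * indicator {0..} r) \<partial>lborel)"
    unfolding distr_lborel_norm_square[OF assms(1)]
    by (subst nn_integral_density) (auto simp: ac_simps)
  finally show ?thesis
    by (simp add: nn_integral_cmult)
qed

section \<open>Parseval's identity on the circle\<close>

text \<open>For \<open>m\<close> nonzero the antiderivative takes the same value at both ends of the
  period. Parametrising the circle by \<open>{0..1}\<close> makes the characters orthonormal without
  a factor \<open>2 * pi\<close>.\<close>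

lemma integral_cis_period:
  "(LINT t:{0..1}|lborel. cis (2 * pi * of_int m * t)) = (if m = 0 then 1 else 0)"
proof (cases "m = 0")
  case True
  then show ?thesis
    by (simp add: set_integral_const)
next
  case False
  define F where "F = (\<lambda>t. cis (2 * pi * of_int m * t) / (2 * pi * \<i> * of_int m))"
  have "(LINT t:{0..1}|lborel. cis (2 * pi * of_int m * t)) = F 1 - F 0"
    unfolding set_lebesgue_integral_def
  proof (rule integral_FTC_Icc)
    fix t :: real
    have "((\<lambda>t. exp (\<i> * of_real (2 * pi * of_int m * t)) / (2 * pi * \<i> * of_int m)) has_vector_derivative
       exp (\<i> * of_real (2 * pi * of_int m * t))) (at t within {0..1})"
      using False
      by (auto intro!: derivative_eq_intros has_vector_derivative_real_field simp: field_simps)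
    then show "(F has_vector_derivative cis (2 * pi * of_int m * t)) (at t within {0..1})"
      by (simp add: F_def cis_conv_exp)
  qed (auto simp: cis_conv_exp intro!: continuous_intros)
  also have "\<dots> = 0"
    using cis_multiple_2pi[of "of_int m"] by (simp add: F_def mult.commute)
  finally show ?thesis
    using False by simp
qed

lemma parseval_partial_sum:
  fixes a :: "nat \<Rightarrow> complex"
  shows "(LINT t:{0..1}|lborel. (norm (\<Sum>k<N. a k * cis (2 * pi * real k * t)))\<^sup>2) = (\<Sum>k<N. (norm (a k))\<^sup>2)"
proof -
  let ?e = "\<lambda>j k t. cis (2 * pi * of_int (int j - int k) * t)"
  have int: "set_integrable lborel {0..1} (\<lambda>t. a j * cnj (a k) * ?e j k t)" for j k
    by (intro borel_integrable_compact[folded set_integrable_def] borel_integrable_atLeastAtMost')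
      (auto simp: cis_conv_exp intro!: continuous_intros)
  \<comment> \<open>The computation moves to the complex numbers, where the squared norm is a
    product with the conjugate and expands into a double sum; orthogonality leaves only its
    diagonal.\<close>
  have "complex_of_real (LINT t:{0..1}|lborel. (norm (\<Sum>k<N. a k * cis (2 * pi * real k * t)))\<^sup>2) =
     (LINT t:{0..1}|lborel. complex_of_real ((norm (\<Sum>k<N. a k * cis (2 * pi * real k * t)))\<^sup>2))"
    unfolding set_lebesgue_integral_def
    by (simp add: scaleR_conv_of_real flip: integral_complex_of_real)
  also have "\<dots> = (LINT t:{0..1}|lborel. (\<Sum>j<N. \<Sum>k<N. a j * cnj (a k) * ?e j k t))"
  proof (rule set_lebesgue_integral_cong)
    have e: "cis (2 * pi * real j * t) * cnj (cis (2 * pi * real k * t)) = ?e j k t" for j k t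
      by (simp add: cis_cnj cis_mult algebra_simps)
    have "complex_of_real ((norm (\<Sum>k<N. a k * cis (2 * pi * real k * t)))\<^sup>2) =
      (\<Sum>j<N. \<Sum>k<N. a j * cnj (a k) * ?e j k t)" for t
      unfolding complex_norm_square cnj_sum sum_product e[symmetric]
      by (intro sum.cong refl) (simp add: mult_ac)
    then show "\<forall>t. t \<in> {0..1} \<longrightarrow> complex_of_real ((norm (\<Sum>k<N. a k * cis (2 * pi * real k * t)))\<^sup>2) =
      (\<Sum>j<N. \<Sum>k<N. a j * cnj (a k) * ?e j k t)"
      by blast
  qed auto
  also have "\<dots> = (\<Sum>j<N. \<Sum>k<N. LINT t:{0..1}|lborel. a j * cnj (a k) * ?e j k t)"
    using int unfolding set_integrable_def set_lebesgue_integral_def scaleR_sum_right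
    by (subst Bochner_Integration.integral_sum; (intro sum.cong refl Bochner_Integration.integral_sum Bochner_Integration.integrable_sum)?) auto
  also have "\<dots> = (\<Sum>j<N. \<Sum>k<N. if j = k then complex_of_real ((norm (a k))\<^sup>2) else 0)"
    unfolding set_integral_mult_right integral_cis_period
    by (intro sum.cong refl) (auto simp: complex_norm_square simp del: of_real_power)
  also have "\<dots> = complex_of_real (\<Sum>k<N. (norm (a k))\<^sup>2)"
    by simp
  finally show ?thesis
    using of_real_eq_iff by blast
qed

text \<open>The limit of the finite identities, by dominated convergence: the squared partial sums
  are bounded on \<open>{0..1}\<close> by the constant
  \<open>(\<Sum>k. norm (a k))\<^sup>2\<close>.\<close>

lemma parseval_absolutely_summable:
  fixes a :: "nat \<Rightarrow> complex"
  assumes a: "summable (\<lambda>k. norm (a k))"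
  shows "(\<lambda>k. (norm (a k))\<^sup>2) sums (LINT t:{0..1}|lborel. (norm (\<Sum>k. a k * cis (2 * pi * real k * t)))\<^sup>2)"
  unfolding sums_def parseval_partial_sum[symmetric] set_lebesgue_integral_def
proof (rule integral_dominated_convergence)
  have sm: "summable (\<lambda>k. a k * cis (2 * pi * real k * t))" for t
    by (rule summable_norm_cancel) (simp add: norm_mult a)
  show "integrable lborel (\<lambda>t::real. indicator {0..1} t *\<^sub>R (\<Sum>k. norm (a k))\<^sup>2 :: real)"
    by simp
  show "AE t in lborel. (\<lambda>N. indicator {0..1} t *\<^sub>R (norm (\<Sum>k<N. a k * cis (2 * pi * real k * t)))\<^sup>2) \<longlonglongrightarrow>
      indicator {0..1} t *\<^sub>R (norm (\<Sum>k. a k * cis (2 * pi * real k * t)))\<^sup>2"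
    by (intro AE_I2 tendsto_intros summable_LIMSEQ sm)
  show "AE t in lborel. norm (indicator {0..1} t *\<^sub>R (norm (\<Sum>k<N. a k * cis (2 * pi * real k * t)))\<^sup>2) \<le>
      indicator {0..1} t *\<^sub>R (\<Sum>k. norm (a k))\<^sup>2" for N
  proof (rule AE_I2)
    fix t
    have "norm (\<Sum>k<N. a k * cis (2 * pi * real k * t)) \<le> (\<Sum>k<N. norm (a k))"
      by (rule order_trans[OF norm_sum]) (simp add: norm_mult)
    also have "\<dots> \<le> (\<Sum>k. norm (a k))"
      by (rule sum_le_suminf[OF a]) auto
    finally show "norm (indicator {0..1} t *\<^sub>R (norm (\<Sum>k<N. a k * cis (2 * pi * real k * t)))\<^sup>2) \<le>
      indicator {0..1} t *\<^sub>R (\<Sum>k. norm (a k))\<^sup>2"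
      by (auto simp: power_mono split: split_indicator)
  qed
qed (auto simp: cis_conv_exp)

section \<open>Taylor coefficients and integrals against a radial weight\<close>

definition taylor_coeff :: "(complex \<Rightarrow> complex) \<Rightarrow> nat \<Rightarrow> complex" where
  "taylor_coeff g k = (deriv ^^ k) g 0 / fact k"

lemma entire_taylor_sums:
  assumes "g holomorphic_on UNIV"
  shows "(\<lambda>k. taylor_coeff g k * z ^ k) sums g z"
  using holomorphic_power_series[of g 0 "norm z + 1" z] assms
  by (auto simp: taylor_coeff_def intro: holomorphic_on_subset)

text \<open>On the circle through \<open>z\<close> the Taylor series is a Fourier series with
  coefficients \<open>taylor_coeff g k * z ^ k\<close>, so Parseval applies. The result is stated in
  \<open>ennreal\<close> so that it can be integrated over \<open>z\<close> term by term without
  integrability conditions.\<close>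

lemma entire_circle_mean:
  assumes g: "g holomorphic_on UNIV"
  shows "(\<integral>\<^sup>+t. ennreal ((norm (g (cis (2 * pi * t) * z)))\<^sup>2) * indicator {0..1} t \<partial>lborel) =
    (\<Sum>k. ennreal ((norm (taylor_coeff g k))\<^sup>2) * ennreal ((norm z)\<^sup>2 ^ k))"
proof -
  define a where "a k = taylor_coeff g k * z ^ k" for k
  \<comment> \<open>The series converges at the point \<open>norm z + 1\<close>, whose modulus
    exceeds that of \<open>z\<close>; hence it converges absolutely at \<open>z\<close>.\<close>
  have abs: "summable (\<lambda>k. norm (a k))"
    unfolding a_def
    by (rule powser_insidea[where x = "of_real (norm z + 1)"])
      (use entire_taylor_sums[OF g] in \<open>auto simp: sums_iff simp del: of_real_add\<close>)
  have series: "(\<Sum>k. a k * cis (2 * pi * real k * t)) = g (cis (2 * pi * t) * z)" for t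
  proof -
    have "a k * cis (2 * pi * real k * t) = taylor_coeff g k * (cis (2 * pi * t) * z) ^ k" for k
      by (simp add: a_def power_mult_distrib Complex.DeMoivre mult_ac)
    then show ?thesis
      using entire_taylor_sums[OF g, of "cis (2 * pi * t) * z"] by (simp add: sums_iff)
  qed
  have cont: "continuous_on {0..1} (\<lambda>t. (norm (g (cis (2 * pi * t) * z)))\<^sup>2)"
    using holomorphic_on_imp_continuous_on[OF g]
    by (auto simp: cis_conv_exp intro!: continuous_intros continuous_on_compose2[of UNIV g])
  have S: "(\<lambda>k. (norm (a k))\<^sup>2) sums (LINT t:{0..1}|lborel. (norm (g (cis (2 * pi * t) * z)))\<^sup>2)"
    using parseval_absolutely_summable[OF abs] unfolding series .
  have "(\<integral>\<^sup>+t. ennreal ((norm (g (cis (2 * pi * t) * z)))\<^sup>2) * indicator {0..1} t \<partial>lborel) =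
      ennreal (LINT t:{0..1}|lborel. (norm (g (cis (2 * pi * t) * z)))\<^sup>2)"
    using cont borel_integrable_atLeastAtMost'[OF cont]
    unfolding set_lebesgue_integral_def set_integrable_def
    by (subst nn_integral_eq_integral[symmetric])
       (auto intro!: nn_integral_cong split: split_indicator)
  also have "\<dots> = (\<Sum>k. ennreal ((norm (a k))\<^sup>2))"
    by (rule suminf_ennreal_eq[OF _ S, symmetric]) simp
  also have "(\<lambda>k. ennreal ((norm (a k))\<^sup>2)) =
      (\<lambda>k. ennreal ((norm (taylor_coeff g k))\<^sup>2) * ennreal ((norm z)\<^sup>2 ^ k))"
  proof
    fix k
    have "(norm (a k))\<^sup>2 = (norm (taylor_coeff g k))\<^sup>2 * (norm z)\<^sup>2 ^ k"
      unfolding a_def norm_mult norm_power power_mult_distrib power_mult[symmetric] mult.commute[of 2 k] ..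
    then show "ennreal ((norm (a k))\<^sup>2) =
        ennreal ((norm (taylor_coeff g k))\<^sup>2) * ennreal ((norm z)\<^sup>2 ^ k)"
      by (simp add: ennreal_mult)
  qed
  finally show ?thesis .
qed

text \<open>A radial weight does not see rotations, so averaging over them replaces the squared norm
  of \<open>g\<close> by its circle mean; different powers of \<open>z\<close> no longer interact,
  and each contributes one moment of \<open>h\<close>. Both sides of the final inequality are
  instances of this formula.\<close>

lemma nn_integral_entire_radial:
  fixes \<alpha> :: real and h :: "real \<Rightarrow> ennreal"
  assumes \<alpha>: "\<alpha> > 0" and g: "g holomorphic_on UNIV" and h[measurable]: "h \<in> borel_measurable borel"
  shows "(\<integral>\<^sup>+z. ennreal ((norm (g z))\<^sup>2) * h (\<alpha> * (norm z)\<^sup>2) \<partial>lborel) =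
    (\<Sum>k. ennreal (pi / \<alpha> * (norm (taylor_coeff g k))\<^sup>2 / \<alpha> ^ k) *
       (\<integral>\<^sup>+r. ennreal (r ^ k) * h r * indicator {0..} r \<partial>lborel))"
proof -
  have g_meas [measurable]: "g \<in> borel_measurable borel"
    using holomorphic_on_imp_continuous_on[OF g] by (rule borel_measurable_continuous_onI)
  have cis_meas [measurable]: "(\<lambda>t. cis (2 * pi * t)) \<in> borel_measurable borel"
    by (intro borel_measurable_continuous_onI) (auto simp: cis_conv_exp intro!: continuous_intros)
  let ?G = "\<lambda>z. ennreal ((norm (g z))\<^sup>2) * h (\<alpha> * (norm z)\<^sup>2)"
  \<comment> \<open>The indicator has integral 1 and brings in the angle \<open>t\<close> over which
    the average is taken.\<close>
  have "(\<integral>\<^sup>+z. ?G z \<partial>lborel) = (\<integral>\<^sup>+t. (\<integral>\<^sup>+z. ?G z \<partial>lborel) * indicator {0..1::real} t \<partial>lborel)"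
    by (subst nn_integral_cmult_indicator) auto
  also have "\<dots> = (\<integral>\<^sup>+t. (\<integral>\<^sup>+z. ?G (cis (2 * pi * t) * z) \<partial>lborel) * indicator {0..1::real} t \<partial>lborel)"
    by (subst nn_integral_rotate[of ?G]) auto
  also have "\<dots> = (\<integral>\<^sup>+t. (\<integral>\<^sup>+z. ?G (cis (2 * pi * t) * z) * indicator {0..1::real} t \<partial>lborel) \<partial>lborel)"
    by (intro nn_integral_cong nn_integral_multc[symmetric]) auto
  also have "\<dots> = (\<integral>\<^sup>+z. (\<integral>\<^sup>+t. ?G (cis (2 * pi * t) * z) * indicator {0..1::real} t \<partial>lborel) \<partial>lborel)"
    by (rule lborel_pair.Fubini') measurable
  also have "\<dots> = (\<integral>\<^sup>+z. h (\<alpha> * (norm z)\<^sup>2) *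
      (\<integral>\<^sup>+t. ennreal ((norm (g (cis (2 * pi * t) * z)))\<^sup>2) * indicator {0..1::real} t \<partial>lborel) \<partial>lborel)"
    by (subst nn_integral_cmult[symmetric]) (measurable, simp add: norm_mult mult_ac)
  \<comment> \<open>Dividing and multiplying by \<open>\<alpha> ^ k\<close> turns the powers of
    \<open>(norm z)\<^sup>2\<close> into powers of the variable of \<open>h\<close>, as the radial
    formula requires.\<close>
  also have "\<dots> = (\<integral>\<^sup>+z. (\<Sum>k. ennreal ((norm (taylor_coeff g k))\<^sup>2 / \<alpha> ^ k) *
      (ennreal ((\<alpha> * (norm (z::complex))\<^sup>2) ^ k) * h (\<alpha> * (norm z)\<^sup>2))) \<partial>lborel)"
  proof (rule nn_integral_cong)
    fix z :: complex
    have "ennreal ((norm (taylor_coeff g k))\<^sup>2) * ennreal ((norm z)\<^sup>2 ^ k) =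
        ennreal ((norm (taylor_coeff g k))\<^sup>2 / \<alpha> ^ k) * ennreal ((\<alpha> * (norm z)\<^sup>2) ^ k)" for k
      using \<alpha> by (simp add: power_mult_distrib flip: ennreal_mult)
    then have "ennreal ((norm (taylor_coeff g k))\<^sup>2) * ennreal ((norm z)\<^sup>2 ^ k) * h (\<alpha> * (norm z)\<^sup>2) =
        ennreal ((norm (taylor_coeff g k))\<^sup>2 / \<alpha> ^ k) *
          (ennreal ((\<alpha> * (norm z)\<^sup>2) ^ k) * h (\<alpha> * (norm z)\<^sup>2))" for k
      by (simp add: mult.assoc)
    then show "h (\<alpha> * (norm z)\<^sup>2) *
      (\<integral>\<^sup>+t. ennreal ((norm (g (cis (2 * pi * t) * z)))\<^sup>2) * indicator {0..1::real} t \<partial>lborel) =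
      (\<Sum>k. ennreal ((norm (taylor_coeff g k))\<^sup>2 / \<alpha> ^ k) *
      (ennreal ((\<alpha> * (norm z)\<^sup>2) ^ k) * h (\<alpha> * (norm z)\<^sup>2)))"
      unfolding entire_circle_mean[OF g]
      by (subst mult.commute, subst ennreal_suminf_multc[symmetric]) (simp only:)
  qed
  also have "\<dots> = (\<Sum>k. ennreal ((norm (taylor_coeff g k))\<^sup>2 / \<alpha> ^ k) *
      (\<integral>\<^sup>+z. ennreal ((\<alpha> * (norm (z::complex))\<^sup>2) ^ k) * h (\<alpha> * (norm z)\<^sup>2) \<partial>lborel))"
    by (subst nn_integral_suminf) (auto simp: nn_integral_cmult)
  also have "\<dots> = (\<Sum>k. ennreal (pi / \<alpha> * (norm (taylor_coeff g k))\<^sup>2 / \<alpha> ^ k) *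
       (\<integral>\<^sup>+r. ennreal (r ^ k) * h r * indicator {0..} r \<partial>lborel))"
  proof (rule suminf_cong)
    fix k
    have "ennreal (pi / \<alpha> * (norm (taylor_coeff g k))\<^sup>2 / \<alpha> ^ k) =
        ennreal ((norm (taylor_coeff g k))\<^sup>2 / \<alpha> ^ k) * ennreal (pi / \<alpha>)"
      using \<alpha> by (subst ennreal_mult[symmetric]) (auto simp: mult.commute)
    then show "ennreal ((norm (taylor_coeff g k))\<^sup>2 / \<alpha> ^ k) *
      (\<integral>\<^sup>+z. ennreal ((\<alpha> * (norm (z::complex))\<^sup>2) ^ k) * h (\<alpha> * (norm z)\<^sup>2) \<partial>lborel) =
      ennreal (pi / \<alpha> * (norm (taylor_coeff g k))\<^sup>2 / \<alpha> ^ k) *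
       (\<integral>\<^sup>+r. ennreal (r ^ k) * h r * indicator {0..} r \<partial>lborel)"
      using \<alpha> nn_integral_radial[of \<alpha> "\<lambda>r. ennreal (r ^ k) * h r"] by (simp add: mult.assoc)
  qed
  finally show ?thesis .
qed

section \<open>The Laguerre weight and its moments\<close>

text \<open>The two alternating signs cancel, so for \<open>r \<ge> 0\<close> all terms are
  nonnegative. The lower bound 1, which is the constant term, rests on this.\<close>

lemma laguerre_minus: "laguerre n (- r) = (\<Sum>j=0..n. real (n choose j) / fact j * r ^ j)"
proof -
  have "(-1) ^ j / fact j * (- r) ^ j = r ^ j / fact j" for j
    using power_mult_distrib[of "-1" "- r" j] by simp
  then show ?thesis
    unfolding laguerre_def by (intro sum.cong) (auto simp: mult.assoc)
qed

lemma laguerre_minus_ge_1: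
  assumes "r \<ge> 0"
  shows "laguerre n (- r) \<ge> 1"
proof -
  have "(\<Sum>j\<in>{0}. real (n choose j) / fact j * r ^ j) \<le> laguerre n (- r)"
    unfolding laguerre_minus using assms by (intro sum_mono2) auto
  then show ?thesis
    by simp
qed

lemma borel_measurable_laguerre [measurable]: "laguerre n \<in> borel_measurable borel"
  unfolding laguerre_def by measurable

text \<open>The integral of \<open>exp (- r) * r ^ m * laguerre n (- r)\<close> over the half-line,
  evaluated term by term with factorials as the moments of \<open>exp (- r)\<close>.\<close>

definition laguerre_moment :: "nat \<Rightarrow> nat \<Rightarrow> real" where
  "laguerre_moment n m = (\<Sum>j=0..n. real (n choose j) / fact j * fact (m + j))"

lemma laguerre_moment_pos: "laguerre_moment n m > 0"
proof -
  have "laguerre_moment n m \<ge> (\<Sum>j\<in>{0}. real (n choose j) / fact j * fact (m + j))"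
    unfolding laguerre_moment_def by (intro sum_mono2) auto
  then show ?thesis
    by (simp add: less_le_trans[OF fact_gt_zero])
qed

lemma has_bochner_integral_exp_power_laguerre:
  "has_bochner_integral lborel (\<lambda>r. indicator {0..} r * (exp (- r) * r ^ m * laguerre n (- r)))
     (laguerre_moment n m)"
proof -
  have "has_bochner_integral lborel
      (\<lambda>r. \<Sum>j=0..n. real (n choose j) / fact j * (r ^ (m + j) * exp (- r) * indicator {0..} r))
      (\<Sum>j=0..n. real (n choose j) / fact j * fact (m + j))"
    by (intro has_bochner_integral_sum has_bochner_integral_mult_right
        has_bochner_integral_I0i_power_exp_m')
  then show ?thesis
    unfolding laguerre_minus laguerre_moment_def by (simp add: sum_distrib_left power_add mult_ac)
qed

lemma set_integrable_exp_power_over_laguerre: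
  "set_integrable lborel {0..} (\<lambda>r. exp (- r) * r ^ m / laguerre n (- r))"
  unfolding set_integrable_def
proof (rule Bochner_Integration.integrable_bound)
  show "integrable lborel (\<lambda>r::real. r ^ m * exp (- r) * indicator {0..} r)"
    using has_bochner_integral_I0i_power_exp_m' by (rule integrable.intros)
  show "AE r in lborel. norm (indicator {0..} r *\<^sub>R (exp (- r) * r ^ m / laguerre n (- r))) \<le>
      norm (r ^ m * exp (- r) * indicator {0..} r :: real)"
  proof (rule AE_I2)
    fix r :: real
    show "norm (indicator {0..} r *\<^sub>R (exp (- r) * r ^ m / laguerre n (- r))) \<le>
        norm (r ^ m * exp (- r) * indicator {0..} r :: real)"
    proof (cases "r \<ge> 0")
      case True
      then have "exp (- r) * r ^ m / laguerre n (- r) \<le> exp (- r) * r ^ m / 1"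
        using laguerre_minus_ge_1[OF True, of n] by (intro divide_left_mono) auto
      then show ?thesis
        using True laguerre_minus_ge_1[OF True, of n] by (simp add: mult.commute)
    qed simp
  qed
qed measurable

section \<open>The ratios of the monomials and their limit\<close>

text \<open>Writing \<open>k = m + n\<close> removes the truncated subtraction and turns the Gamma
  values into factorials.\<close>

lemma monomial_ratio_eq:
  "monomial_ratio n (m + n) = fact (m + n) / (fact n * (fact m)\<^sup>2) *
     (LINT r:{0..}|lborel. exp (- r) * r ^ m / laguerre n (- r))"
  using Gamma_fact[of "m + n", where 'a = real] Gamma_fact[of m, where 'a = real]
  by (simp add: monomial_ratio_def add.commute add.assoc)

lemma monomial_ratio_nonneg: "monomial_ratio n (m + n) \<ge> 0"
proof -
  have "exp (- r) * r ^ m / laguerre n (- r) \<ge> 0" if "r \<ge> 0" for r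
    using laguerre_minus_ge_1[OF that, of n] that by simp
  then have "(LINT r:{0..}|lborel. exp (- r) * r ^ m / laguerre n (- r)) \<ge> 0"
    unfolding set_lebesgue_integral_def
    by (intro Bochner_Integration.integral_nonneg) (auto split: split_indicator)
  then show ?thesis
    by (simp add: monomial_ratio_eq)
qed

text \<open>
  The tangent-line bound \<open>1 / L \<ge> 2 t - t\<^sup>2 L\<close>, integrated with the optimal
  constant \<open>t\<close>, replaces the Cauchy--Schwarz inequality.
\<close>

lemma integral_over_laguerre_ge:
  "(LINT r:{0..}|lborel. exp (- r) * r ^ m / laguerre n (- r)) \<ge> (fact m)\<^sup>2 / laguerre_moment n m"
proof -
  \<comment> \<open>The maximum point of the concave quadratic
    \<open>2 * t * fact m - t\<^sup>2 * laguerre_moment n m\<close>.\<close>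
  define t where "t = fact m / laguerre_moment n m"
  let ?lower = "\<lambda>r. 2 * t * (r ^ m * exp (- r) * indicator {0..} r) -
      t\<^sup>2 * (indicator {0..} r * (exp (- r) * r ^ m * laguerre n (- r)))"
  have lower: "has_bochner_integral lborel ?lower (2 * t * fact m - t\<^sup>2 * laguerre_moment n m)"
    by (intro has_bochner_integral_diff has_bochner_integral_mult_right
        has_bochner_integral_I0i_power_exp_m' has_bochner_integral_exp_power_laguerre)
  have "2 * t * fact m - t\<^sup>2 * laguerre_moment n m = (LINT r|lborel. ?lower r)"
    using lower by (simp add: has_bochner_integral_integral_eq)
  also have "\<dots> \<le> (LINT r:{0..}|lborel. exp (- r) * r ^ m / laguerre n (- r))"
    unfolding set_lebesgue_integral_def
  proof (rule integral_mono)
    show "integrable lborel ?lower"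
      using lower by (rule integrable.intros)
    show "integrable lborel (\<lambda>r. indicator {0..} r *\<^sub>R (exp (- r) * r ^ m / laguerre n (- r)))"
      using set_integrable_exp_power_over_laguerre unfolding set_integrable_def .
    fix r :: real
    show "?lower r \<le> indicator {0..} r *\<^sub>R (exp (- r) * r ^ m / laguerre n (- r))"
    proof (cases "r \<ge> 0")
      case True
      define L where "L = laguerre n (- r)"
      have L: "L > 0"
        using laguerre_minus_ge_1[OF True, of n] by (simp add: L_def)
      have "0 \<le> (1 - t * L)\<^sup>2 / L"
        using L by simp
      also have "\<dots> = 1 / L - (2 * t - t\<^sup>2 * L)"
        using L by (simp add: power2_eq_square field_simps)
      finally have "(r ^ m * exp (- r)) * (2 * t - t\<^sup>2 * L) \<le> (r ^ m * exp (- r)) * (1 / L)"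
        using True by (intro mult_left_mono) auto
      then show ?thesis
        using True by (simp add: L_def[symmetric] algebra_simps)
    qed simp
  qed
  also have "2 * t * fact m - t\<^sup>2 * laguerre_moment n m = (fact m)\<^sup>2 / laguerre_moment n m"
    using laguerre_moment_pos[of n m] by (simp add: t_def power2_eq_square field_simps)
  finally show ?thesis .
qed

text \<open>With \<open>k = m + n\<close>, the previous bound gives at least
  \<open>fact k / (fact n * laguerre_moment n m)\<close>. The denominator is \<open>fact k\<close>
  up to a relative error of order \<open>1 / k\<close>, with a constant \<open>C n\<close> that does
  not depend on \<open>m\<close>.\<close>

lemma monomial_ratio_ge:
  defines "C \<equiv> \<lambda>n. \<Sum>j<n. real (n choose j) * fact n / fact j"
  assumes "m + n > 0"
  shows "monomial_ratio n (m + n) \<ge> 1 / (1 + C n / real (m + n))"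
proof -
  let ?k = "m + n"
  define B where "B = laguerre_moment n m"
  have B: "B > 0"
    by (simp add: B_def laguerre_moment_pos)
  \<comment> \<open>The top index \<open>j = n\<close> is split off because it yields exactly
    \<open>fact ?k\<close>; for \<open>j < n\<close> the factorial \<open>fact (m + j)\<close> is at
    most \<open>fact (?k - 1)\<close>, which gains the factor \<open>1 / ?k\<close>.\<close>
  have "{0..n} = insert n {..<n}"
    by auto
  then have "fact n * B = fact ?k + (\<Sum>j<n. real (n choose j) * fact n / fact j * fact (m + j))"
    by (simp add: B_def laguerre_moment_def algebra_simps sum_distrib_left)
  also have "(\<Sum>j<n. real (n choose j) * fact n / fact j * fact (m + j)) \<le>
      (\<Sum>j<n. real (n choose j) * fact n / fact j * (fact ?k / ?k))"
  proof (rule sum_mono)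
    fix j assume "j \<in> {..<n}"
    then have "fact (m + j) \<le> (fact (?k - 1) :: real)"
      by (intro fact_mono) auto
    also have "\<dots> = fact ?k / ?k"
      using assms(2) fact_reduce[of ?k, where 'a = real] by (simp del: of_nat_add)
    finally show "real (n choose j) * fact n / fact j * fact (m + j) \<le>
        real (n choose j) * fact n / fact j * (fact ?k / ?k)"
      by (intro mult_left_mono) auto
  qed
  also have "fact ?k + \<dots> = fact ?k * (1 + C n / ?k)"
    unfolding C_def sum_distrib_right[symmetric]
    by (simp add: distrib_left mult.commute del: of_nat_add)
  finally have "fact n * B \<le> fact ?k * (1 + C n / ?k)"
    by simp
  moreover have "C n \<ge> 0"
    unfolding C_def by (intro sum_nonneg) auto
  then have "1 + C n / ?k > 0"
    by (simp add: add_pos_nonneg)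
  ultimately have "1 / (1 + C n / ?k) \<le> fact ?k / (fact n * B)"
    using B by (simp add: divide_simps mult.commute)
  also have "\<dots> = fact ?k / (fact n * (fact m)\<^sup>2) * ((fact m)\<^sup>2 / B)"
    by simp
  also have "\<dots> \<le> monomial_ratio n ?k"
    unfolding monomial_ratio_eq B_def
    by (intro mult_left_mono integral_over_laguerre_ge) auto
  finally show ?thesis .
qed

lemma eventually_monomial_ratio_gt:
  assumes "c < 1"
  shows "eventually (\<lambda>m. monomial_ratio n (m + n) > c) sequentially"
proof -
  define C where "C = (\<Sum>j<n. real (n choose j) * fact n / fact j)"
  have "(\<lambda>m. 1 / (1 + C / real (m + n))) \<longlonglongrightarrow> 1 / (1 + 0)"
    by (intro tendsto_intros LIMSEQ_ignore_initial_segment[OF lim_const_over_n]) auto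
  then have "eventually (\<lambda>m. 1 / (1 + C / real (m + n)) > c) sequentially"
    using assms by (intro order_tendstoD) auto
  then show ?thesis
    \<comment> \<open>Taking \<open>m > 0\<close> keeps \<open>m + n\<close> positive also when
      \<open>n = 0\<close>.\<close>
    using eventually_gt_at_top[of 0]
    by eventually_elim (use monomial_ratio_ge[of _ n] in \<open>force simp: C_def intro: less_le_trans\<close>)
qed

section \<open>Coefficient expansions of the two integrals\<close>

text \<open>The radial formula for the weight \<open>exp (- r)\<close>, whose moments are
  factorials. The factor \<open>pi / \<alpha>\<close> is kept inside the terms, so that they can be
  compared directly with those of the weighted derivative.\<close>

lemma nn_integral_fock:
  assumes \<alpha>: "\<alpha> > 0" and f: "f holomorphic_on UNIV"
  shows "(\<integral>\<^sup>+z. ennreal ((norm (f z))\<^sup>2 * exp (- \<alpha> * (norm z)\<^sup>2)) \<partial>lborel) =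
    (\<Sum>k. ennreal (pi / \<alpha> * (norm (taylor_coeff f k))\<^sup>2 / \<alpha> ^ k * fact k))"
proof -
  have "(\<integral>\<^sup>+z. ennreal ((norm (f z))\<^sup>2 * exp (- \<alpha> * (norm z)\<^sup>2)) \<partial>lborel) =
      (\<integral>\<^sup>+z. ennreal ((norm (f z))\<^sup>2) * ennreal (exp (- (\<alpha> * (norm z)\<^sup>2))) \<partial>lborel)"
    by (simp add: ennreal_mult)
  also have "\<dots> = (\<Sum>k. ennreal (pi / \<alpha> * (norm (taylor_coeff f k))\<^sup>2 / \<alpha> ^ k) *
       (\<integral>\<^sup>+r. ennreal (r ^ k) * ennreal (exp (- r)) * indicator {0..} r \<partial>lborel))"
    by (rule nn_integral_entire_radial[OF \<alpha> f, of "\<lambda>r. ennreal (exp (- r))"]) measurable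
  also have "\<dots> = (\<Sum>k. ennreal (pi / \<alpha> * (norm (taylor_coeff f k))\<^sup>2 / \<alpha> ^ k * fact k))"
  proof (rule suminf_cong)
    fix k
    have "(\<integral>\<^sup>+r. ennreal (r ^ k) * ennreal (exp (- r)) * indicator {0..} r \<partial>lborel) = ennreal (fact k)"
      using nn_intergal_power_times_exp_Ici[of k] by (simp add: ennreal_mult'')
    then show "ennreal (pi / \<alpha> * (norm (taylor_coeff f k))\<^sup>2 / \<alpha> ^ k) *
       (\<integral>\<^sup>+r. ennreal (r ^ k) * ennreal (exp (- r)) * indicator {0..} r \<partial>lborel) =
       ennreal (pi / \<alpha> * (norm (taylor_coeff f k))\<^sup>2 / \<alpha> ^ k * fact k)"
      by (simp only: ennreal_mult''[OF fact_ge_zero])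
  qed
  finally show ?thesis .
qed

lemma taylor_coeff_higher_deriv:
  "taylor_coeff ((deriv ^^ n) f) j = fact (j + n) / fact j * taylor_coeff f (j + n)"
  by (simp add: taylor_coeff_def funpow_add)

text \<open>Differentiation shifts the Taylor coefficients by \<open>n\<close> and multiplies them
  by quotients of factorials. Together with the moments of the weight, these constants assemble into
  \<open>monomial_ratio\<close>, leaving the Fock terms of index at least \<open>n\<close>.\<close>

lemma nn_integral_weighted_deriv:
  assumes \<alpha>: "\<alpha> > 0" and f: "f holomorphic_on UNIV"
  shows "(\<integral>\<^sup>+z. ennreal (weighted_deriv \<alpha> n f z) \<partial>lborel) =
    (\<Sum>j. ennreal (monomial_ratio n (j + n)) *
       ennreal (pi / \<alpha> * (norm (taylor_coeff f (j + n)))\<^sup>2 / \<alpha> ^ (j + n) * fact (j + n)))"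
proof -
  let ?w = "\<lambda>r. exp (- r) / (\<alpha> ^ n * fact n * laguerre n (- r))"
  let ?g = "(deriv ^^ n) f"
  have "(\<integral>\<^sup>+z. ennreal (weighted_deriv \<alpha> n f z) \<partial>lborel) =
      (\<integral>\<^sup>+z. ennreal ((norm (?g z))\<^sup>2) * ennreal (?w (\<alpha> * (norm z)\<^sup>2)) \<partial>lborel)"
    by (simp add: weighted_deriv_def flip: ennreal_mult')
  also have "\<dots> = (\<Sum>j. ennreal (pi / \<alpha> * (norm (taylor_coeff ?g j))\<^sup>2 / \<alpha> ^ j) *
       (\<integral>\<^sup>+r. ennreal (r ^ j) * ennreal (?w r) * indicator {0..} r \<partial>lborel))"
    by (rule nn_integral_entire_radial[OF \<alpha>, of ?g "\<lambda>r. ennreal (?w r)"])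
       (auto intro!: holomorphic_higher_deriv f)
  also have "\<dots> = (\<Sum>j. ennreal (monomial_ratio n (j + n)) *
       ennreal (pi / \<alpha> * (norm (taylor_coeff f (j + n)))\<^sup>2 / \<alpha> ^ (j + n) * fact (j + n)))"
  proof (rule suminf_cong)
    fix j
    let ?I = "LINT r:{0..}|lborel. exp (- r) * r ^ j / laguerre n (- r)"
    have pos: "exp (- r) * r ^ j / laguerre n (- r) \<ge> 0" if "r \<ge> 0" for r
      using laguerre_minus_ge_1[OF that, of n] that by simp
    then have "?I \<ge> 0"
      unfolding set_lebesgue_integral_def
      by (intro Bochner_Integration.integral_nonneg) (auto split: split_indicator)
    have "(\<integral>\<^sup>+r. ennreal (r ^ j) * ennreal (?w r) * indicator {0..} r \<partial>lborel) =
        (\<integral>\<^sup>+r. ennreal (1 / (\<alpha> ^ n * fact n)) *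
          ennreal (indicator {0..} r *\<^sub>R (exp (- r) * r ^ j / laguerre n (- r))) \<partial>lborel)"
      using \<alpha> pos
      by (intro nn_integral_cong) (auto simp flip: ennreal_mult' simp: mult_ac split: split_indicator)
    also have "\<dots> = ennreal (1 / (\<alpha> ^ n * fact n)) * ennreal ?I"
      using set_integrable_exp_power_over_laguerre[of j n] pos
      unfolding set_integrable_def set_lebesgue_integral_def
      by (subst nn_integral_cmult; (subst nn_integral_eq_integral)?) (auto split: split_indicator)
    finally have int: "(\<integral>\<^sup>+r. ennreal (r ^ j) * ennreal (?w r) * indicator {0..} r \<partial>lborel) =
        ennreal (?I / (\<alpha> ^ n * fact n))"
      using \<alpha> by (simp flip: ennreal_mult')
    \<comment> \<open>Of the two factors \<open>fact (j + n)\<close> in the squared coefficient, one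
      goes into \<open>monomial_ratio\<close> and the other into the Fock term.\<close>
    have "pi / \<alpha> * (norm (taylor_coeff ?g j))\<^sup>2 / \<alpha> ^ j * (?I / (\<alpha> ^ n * fact n)) =
        monomial_ratio n (j + n) *
          (pi / \<alpha> * (norm (taylor_coeff f (j + n)))\<^sup>2 / \<alpha> ^ (j + n) * fact (j + n))"
      using \<alpha> by (simp add: monomial_ratio_eq taylor_coeff_higher_deriv norm_mult norm_divide
          power_add field_simps power2_eq_square)
    then show "ennreal (pi / \<alpha> * (norm (taylor_coeff ?g j))\<^sup>2 / \<alpha> ^ j) *
       (\<integral>\<^sup>+r. ennreal (r ^ j) * ennreal (?w r) * indicator {0..} r \<partial>lborel) =
       ennreal (monomial_ratio n (j + n)) *
       ennreal (pi / \<alpha> * (norm (taylor_coeff f (j + n)))\<^sup>2 / \<alpha> ^ (j + n) * fact (j + n))"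
      using \<alpha> \<open>?I \<ge> 0\<close> monomial_ratio_nonneg[of n j]
      unfolding int by (subst (1 2) ennreal_mult[symmetric]) auto
  qed
  finally show ?thesis .
qed

section \<open>The inequality\<close>

lemma borel_measurable_entire:
  assumes "f holomorphic_on UNIV"
  shows "f \<in> borel_measurable borel"
  using holomorphic_on_imp_continuous_on[OF assms] by (rule borel_measurable_continuous_onI)

lemma weighted_deriv_nonneg:
  assumes "\<alpha> > 0"
  shows "weighted_deriv \<alpha> n f z \<ge> 0"
proof -
  have "laguerre n (- (\<alpha> * (norm z)\<^sup>2)) \<ge> 1"
    using assms by (intro laguerre_minus_ge_1) simp
  then show ?thesis
    using assms by (simp add: weighted_deriv_def)
qed

lemma borel_measurable_weighted_deriv:
  assumes "f holomorphic_on UNIV"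
  shows "weighted_deriv \<alpha> n f \<in> borel_measurable borel"
proof -
  have [measurable]: "(deriv ^^ n) f \<in> borel_measurable borel"
    using assms by (intro borel_measurable_entire holomorphic_higher_deriv) auto
  show ?thesis
    unfolding weighted_deriv_def by measurable
qed

lemma fock_norm_square:
  assumes "\<alpha> > 0"
  shows "(fock_norm \<alpha> f)\<^sup>2 =
    \<alpha> / pi * (LINT z|lborel. (norm (f z))\<^sup>2 * exp (- \<alpha> * (norm z)\<^sup>2))"
  unfolding fock_norm_def using assms
  by (intro real_sqrt_pow2 mult_nonneg_nonneg Bochner_Integration.integral_nonneg) auto

text \<open>The comparison is made between nonnegative integrals in \<open>ennreal\<close>. The
  right-hand side is finite for \<open>f\<close> in the Fock space, so one chain of estimates yields
  both integrability and the bound.\<close>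

lemma weighted_deriv_bound:
  assumes \<alpha>: "\<alpha> > 0" and ratio: "\<And>k. k \<ge> n \<Longrightarrow> monomial_ratio n k < 1"
    and f: "f \<in> fock_space \<alpha>"
  shows "integrable lborel (weighted_deriv \<alpha> n f) \<and> deriv_functional \<alpha> n f \<le> (fock_norm \<alpha> f)\<^sup>2"
proof -
  have hol: "f holomorphic_on UNIV"
    and int: "integrable lborel (\<lambda>z. (norm (f z))\<^sup>2 * exp (- \<alpha> * (norm z)\<^sup>2))"
    using f by (auto simp: fock_space_def)
  let ?N = "LINT z|lborel. (norm (f z))\<^sup>2 * exp (- \<alpha> * (norm z)\<^sup>2)"
  let ?B = "\<lambda>k. ennreal (pi / \<alpha> * (norm (taylor_coeff f k))\<^sup>2 / \<alpha> ^ k * fact k)"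
  note [measurable] = borel_measurable_weighted_deriv[OF hol]
  have "(\<integral>\<^sup>+z. ennreal (weighted_deriv \<alpha> n f z) \<partial>lborel) =
      (\<Sum>j. ennreal (monomial_ratio n (j + n)) * ?B (j + n))"
    by (rule nn_integral_weighted_deriv[OF \<alpha> hol])
  also have "\<dots> \<le> (\<Sum>j. ?B (j + n))"
  proof (intro suminf_le summableI)
    fix j
    have "ennreal (monomial_ratio n (j + n)) \<le> 1"
      using ratio[of "j + n"] by simp
    then show "ennreal (monomial_ratio n (j + n)) * ?B (j + n) \<le> ?B (j + n)"
      using mult_right_mono[of _ 1 "?B (j + n)"] by simp
  qed
  \<comment> \<open>The terms of index below \<open>n\<close>, which the derivative annihilates, are
    nonnegative and are added back.\<close>
  also have "\<dots> \<le> (\<Sum>k. ?B k)"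
    by (subst suminf_offset[of ?B n]) (auto intro: summableI)
  also have "\<dots> = (\<integral>\<^sup>+z. ennreal ((norm (f z))\<^sup>2 * exp (- \<alpha> * (norm z)\<^sup>2)) \<partial>lborel)"
    by (rule nn_integral_fock[OF \<alpha> hol, symmetric])
  also have "\<dots> = ennreal ?N"
    using int by (rule nn_integral_eq_integral) simp
  finally have le: "(\<integral>\<^sup>+z. ennreal (weighted_deriv \<alpha> n f z) \<partial>lborel) \<le> ennreal ?N" .
  have "integrable lborel (weighted_deriv \<alpha> n f)"
    using le_less_trans[OF le] by (intro integrableI_nonneg) (auto simp: weighted_deriv_nonneg[OF \<alpha>])
  moreover have "(LINT z|lborel. weighted_deriv \<alpha> n f z) \<le> ?N"
    using le by (intro integral_real_bounded) (auto intro!: Bochner_Integration.integral_nonneg)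
  ultimately show ?thesis
    unfolding fock_norm_square[OF \<alpha>] deriv_functional_def
    using \<alpha> by (intro conjI mult_left_mono) auto
qed

section \<open>Sharpness on monomials\<close>

lemma taylor_coeff_power: "taylor_coeff (\<lambda>z. z ^ m) k = (if k = m then 1 else 0)"
proof -
  have "(deriv ^^ k) (\<lambda>z::complex. z ^ m) 0 = pochhammer (of_nat (Suc m - k)) k * 0 ^ (m - k)"
    using higher_deriv_power[of k 0 m "0 :: complex"] by simp
  \<comment> \<open>For \<open>k < m\<close> the power of 0 vanishes. For \<open>k > m\<close>
    truncated subtraction makes that power 1, but \<open>Suc m - k\<close> is then 0 and the
    Pochhammer symbol vanishes.\<close>
  also have "\<dots> = (if k = m then fact m else 0)"
    by (cases k m rule: linorder_cases) (auto simp: pochhammer_fact pochhammer_0_left)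
  finally show ?thesis
    by (simp add: taylor_coeff_def)
qed

lemma
  assumes \<alpha>: "\<alpha> > 0"
  shows power_in_fock_space: "(\<lambda>z. z ^ k) \<in> fock_space \<alpha>"
    and fock_norm_power: "(fock_norm \<alpha> (\<lambda>z. z ^ k))\<^sup>2 = fact k / \<alpha> ^ k"
proof -
  let ?f = "\<lambda>z::complex. z ^ k"
  let ?F = "\<lambda>z. (norm (?f z))\<^sup>2 * exp (- \<alpha> * (norm z)\<^sup>2)"
  have hol: "?f holomorphic_on UNIV"
    by (intro holomorphic_intros)
  have "(\<integral>\<^sup>+z. ennreal (?F z) \<partial>lborel) =
      (\<Sum>j. ennreal (pi / \<alpha> * (norm (taylor_coeff ?f j))\<^sup>2 / \<alpha> ^ j * fact j))"
    by (rule nn_integral_fock[OF \<alpha> hol])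
  also have "\<dots> = ennreal (pi / \<alpha> / \<alpha> ^ k * fact k)"
    by (subst suminf_finite[of "{k}"]) (auto simp: taylor_coeff_power)
  finally have "integrable lborel ?F \<and> integral\<^sup>L lborel ?F = pi / \<alpha> / \<alpha> ^ k * fact k"
    using \<alpha> by (subst nn_integral_eq_integrable[symmetric]) auto
  then show "?f \<in> fock_space \<alpha>" "(fock_norm \<alpha> ?f)\<^sup>2 = fact k / \<alpha> ^ k"
    using hol \<alpha> unfolding fock_norm_square[OF \<alpha>] by (auto simp: fock_space_def)
qed

text \<open>Only the term \<open>j = m\<close> of the expansion survives. The factor after
  \<open>monomial_ratio\<close> is the squared Fock norm of the monomial, so the ratio is exactly
  the quotient of the two sides of the inequality.\<close>

lemma deriv_functional_power:
  assumes \<alpha>: "\<alpha> > 0"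
  shows "deriv_functional \<alpha> n (\<lambda>z. z ^ (m + n)) = monomial_ratio n (m + n) * (fact (m + n) / \<alpha> ^ (m + n))"
proof -
  let ?f = "\<lambda>z::complex. z ^ (m + n)"
  have hol: "?f holomorphic_on UNIV"
    by (intro holomorphic_intros)
  note [measurable] = borel_measurable_weighted_deriv[OF hol]
  have "(\<integral>\<^sup>+z. ennreal (weighted_deriv \<alpha> n ?f z) \<partial>lborel) =
      (\<Sum>j. ennreal (monomial_ratio n (j + n)) *
       ennreal (pi / \<alpha> * (norm (taylor_coeff ?f (j + n)))\<^sup>2 / \<alpha> ^ (j + n) * fact (j + n)))"
    by (rule nn_integral_weighted_deriv[OF \<alpha> hol])
  also have "\<dots> = ennreal (monomial_ratio n (m + n)) * ennreal (pi / \<alpha> / \<alpha> ^ (m + n) * fact (m + n))"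
    by (subst suminf_finite[of "{m}"]) (auto simp: taylor_coeff_power)
  also have "\<dots> = ennreal (monomial_ratio n (m + n) * (pi / \<alpha> / \<alpha> ^ (m + n) * fact (m + n)))"
    by (rule ennreal_mult'[symmetric, OF monomial_ratio_nonneg])
  finally have "(LINT z|lborel. weighted_deriv \<alpha> n ?f z) =
      monomial_ratio n (m + n) * (pi / \<alpha> / \<alpha> ^ (m + n) * fact (m + n))"
    using \<alpha> monomial_ratio_nonneg[of n m]
    by (subst integral_eq_nn_integral) (auto simp: weighted_deriv_nonneg)
  then show ?thesis
    using \<alpha> by (simp add: deriv_functional_def)
qed

theorem lemma2p5:
  fixes \<alpha> :: real and n :: nat
  assumes "\<alpha> > 0"
    and "\<And>k. k \<ge> n \<Longrightarrow> monomial_ratio n k < 1"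
  shows "(\<forall>f \<in> fock_space \<alpha>. integrable lborel (weighted_deriv \<alpha> n f)
            \<and> deriv_functional \<alpha> n f \<le> (fock_norm \<alpha> f)\<^sup>2)
       \<and> (\<forall>c<1. \<exists>f \<in> fock_space \<alpha>. f \<noteq> (\<lambda>z. 0)
            \<and> deriv_functional \<alpha> n f > c * (fock_norm \<alpha> f)\<^sup>2)"
proof (intro conjI ballI allI impI)
  fix f assume "f \<in> fock_space \<alpha>"
  then show "integrable lborel (weighted_deriv \<alpha> n f)" "deriv_functional \<alpha> n f \<le> (fock_norm \<alpha> f)\<^sup>2"
    using weighted_deriv_bound[OF assms] by auto
next
  fix c :: real assume "c < 1"
  \<comment> \<open>The ratios tend to 1, so some degree \<open>m + n\<close> has a ratio above
    \<open>c\<close>; the monomial of that degree is the witness.\<close>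
  then obtain m where m: "monomial_ratio n (m + n) > c"
    using eventually_happens[OF eventually_monomial_ratio_gt[of c n]] by auto
  let ?f = "\<lambda>z::complex. z ^ (m + n)"
  have "deriv_functional \<alpha> n ?f > c * (fock_norm \<alpha> ?f)\<^sup>2"
    unfolding deriv_functional_power[OF assms(1)] fock_norm_power[OF assms(1)]
    using m assms(1) by (intro mult_strict_right_mono) auto
  moreover have "?f \<noteq> (\<lambda>z. 0)"
    by (auto simp: fun_eq_iff intro!: exI[of _ 1])
  ultimately show "\<exists>f \<in> fock_space \<alpha>. f \<noteq> (\<lambda>z. 0) \<and> deriv_functional \<alpha> n f > c * (fock_norm \<alpha> f)\<^sup>2"
    using power_in_fock_space[OF assms(1), of "m + n"] by blast
qed

end
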